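(* Consider the following algorithm for the 1-round TCAND problem on input $(V,\mathcal{F},T)$, $V=[n]$: compute an optimal solution $(y,z)$ of the linear program $$\begin{array}{lll}\text{minimize} & \sum_{j=1}^n y_j & \\ \text{subject to} & y_i+\sum_{LS:\,(LS\to i)\in\mathcal{F}} z_{LS}\ge 1 & \forall i\in T,\\ & z_{LS}\le y_j & \forall j\in LS,\ \text{for all } (LS\to i)\in\mathcal{F} \text{ with } i\in T,\\ & y_j,\,z_{LS}\in[0,1] & \forall j\in V,\ \forall LS \text{ with } (LS\to i)\in\mathcal{F} \text{ for some } i\in T,\end{array}$$ and output $I=\{i\in V: y_i\ge \tfrac{1}{f+1}\}$. This algorithm is an $(f+1)$-approximation for the 1-round TCAND problem, where $f=\max_{i\in V}|\{X\subseteq V: (X\to i)\in\mathcal{F}\}|$.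
   Context: Let $V=[n]=\{1,\dots,n\}$ be a finite set of attributes (variables). A functional dependency (FD) over $V$ is an expression $LS\to i$ with $LS\subseteq V$ and $i\in V$ (an FD with several attributes on the right-hand side is identified with the corresponding set of FDs with single-attribute right-hand sides). $\mathcal{F}$ is a finite set of FDs and $T\subseteq V$ is a set of target variables. 1-round TCAND: find a set $X\subseteq V$ of minimum cardinality such that the one-step closure of $X$ contains $T$; the one-step closure of $X$ is $X\cup\{i\in V: \exists (LS\to i)\in\mathcal{F},\ LS\subseteq X\}$. Such a set $X$ is called feasible. The variables $z_{LS}$ are indexed by the left-hand sides of FDs. A $\rho$-approximation means that the output is feasible and has cardinality at most $\rho\cdot\mathrm{OPT}$, where $\mathrm{OPT}$ is the minimum cardinality of a feasible set. *)

theory Defs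
  imports Complex_Main
begin

text \<open>
  The attributes are \<open>{1..n}\<close>.  A pair \<open>(LS, i)\<close> stands for the functional dependency
  \<open>LS \<rightarrow> i\<close>; the left-hand side may be empty and may contain \<open>i\<close>.
\<close>

type_synonym fd = "nat set \<times> nat"

definition fds_over :: "nat \<Rightarrow> fd set \<Rightarrow> bool" where
  "fds_over n F \<longleftrightarrow> finite F \<and> (\<forall>(LS, i) \<in> F. LS \<subseteq> {1..n} \<and> i \<in> {1..n})"

definition one_step_closure :: "nat \<Rightarrow> fd set \<Rightarrow> nat set \<Rightarrow> nat set" where
  "one_step_closure n F X = X \<union> {i \<in> {1..n}. \<exists>LS. (LS, i) \<in> F \<and> LS \<subseteq> X}"

definition tcand1_feasible :: "nat \<Rightarrow> fd set \<Rightarrow> nat set \<Rightarrow> nat set \<Rightarrow> bool" where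
  "tcand1_feasible n F T X \<longleftrightarrow> X \<subseteq> {1..n} \<and> T \<subseteq> one_step_closure n F X"

text \<open>For \<open>T \<subseteq> {1..n}\<close> the set \<open>{1..n}\<close> is feasible, so the minimum is over a nonempty finite set.\<close>

definition tcand1_opt :: "nat \<Rightarrow> fd set \<Rightarrow> nat set \<Rightarrow> nat" where
  "tcand1_opt n F T = Min (card ` {X. tcand1_feasible n F T X})"

text \<open>
  An algorithm that may make choices (here: which optimal LP solution is used) is represented by
  the set of its possible outputs on the given instance.  It has to produce some output, and the
  guarantee must hold for each possible one.
\<close>

definition tcand1_approximation :: "nat \<Rightarrow> fd set \<Rightarrow> nat set \<Rightarrow> real \<Rightarrow> nat set set \<Rightarrow> bool" where
  "tcand1_approximation n F T \<rho> outputs \<longleftrightarrow>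
     outputs \<noteq> {} \<and>
     (\<forall>I \<in> outputs. tcand1_feasible n F T I \<and> real (card I) \<le> \<rho> * real (tcand1_opt n F T))"

text \<open>
  The LP variables are total functions; only \<open>y j\<close> for \<open>j \<in> {1..n}\<close> and \<open>z LS\<close> for left-hand sides
  \<open>LS\<close> of dependencies with target right-hand side are constrained or used.  One variable \<open>z LS\<close>
  is shared by all dependencies with left-hand side \<open>LS\<close>.
\<close>

definition lp_feasible ::
    "nat \<Rightarrow> fd set \<Rightarrow> nat set \<Rightarrow> (nat \<Rightarrow> real) \<Rightarrow> (nat set \<Rightarrow> real) \<Rightarrow> bool" where
  "lp_feasible n F T y z \<longleftrightarrow>
     (\<forall>i \<in> T. y i + (\<Sum>LS \<in> {LS. (LS, i) \<in> F}. z LS) \<ge> 1) \<and>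
     (\<forall>(LS, i) \<in> F. i \<in> T \<longrightarrow> (\<forall>j \<in> LS. z LS \<le> y j)) \<and>
     (\<forall>j \<in> {1..n}. 0 \<le> y j \<and> y j \<le> 1) \<and>
     (\<forall>(LS, i) \<in> F. i \<in> T \<longrightarrow> 0 \<le> z LS \<and> z LS \<le> 1)"

definition lp_optimal ::
    "nat \<Rightarrow> fd set \<Rightarrow> nat set \<Rightarrow> (nat \<Rightarrow> real) \<Rightarrow> (nat set \<Rightarrow> real) \<Rightarrow> bool" where
  "lp_optimal n F T y z \<longleftrightarrow>
     lp_feasible n F T y z \<and>
     (\<forall>y' z'. lp_feasible n F T y' z' \<longrightarrow> (\<Sum>j = 1..n. y j) \<le> (\<Sum>j = 1..n. y' j))"

text \<open>For \<open>n = 0\<close> the value is unspecified; then every feasible set is empty and it plays no role.\<close>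

definition max_lhs_count :: "nat \<Rightarrow> fd set \<Rightarrow> nat" where
  "max_lhs_count n F = Max ((\<lambda>i. card {X. X \<subseteq> {1..n} \<and> (X, i) \<in> F}) ` {1..n})"

definition lp_rounding_outputs :: "nat \<Rightarrow> fd set \<Rightarrow> nat set \<Rightarrow> nat set set" where
  "lp_rounding_outputs n F T =
     {I. \<exists>y z. lp_optimal n F T y z \<and>
           I = {i \<in> {1..n}. y i \<ge> 1 / (real (max_lhs_count n F) + 1)}}"

end

theory Submission
  imports Defs "HOL-Analysis.Function_Topology"
begin

text \<open>
  In the constraint of a target \<open>i\<close> at most \<open>f + 1\<close> variables sum to at least 1, so one of them is
  at least \<open>1 / (f + 1)\<close>: either \<open>y i\<close>, or some \<open>z LS\<close>, in which case \<open>y j \<ge> z LS\<close> puts all of \<open>LS\<close>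
  into the output.  Rounding up costs a factor \<open>f + 1\<close>, and indicator functions of feasible sets
  are LP solutions, so the LP optimum is at most OPT.  An optimal LP solution exists by compactness.
\<close>

text \<open>Tychonoff's theorem. Since the LP variables are total functions, the cube may have
  infinitely many coordinates, and closed and bounded would not suffice.\<close>

lemma compact_unit_cube: "compact {g :: 'a \<Rightarrow> real. \<forall>x. g x \<in> {0..1}}"
proof -
  have "compactin (product_topology (\<lambda>_. euclidean) UNIV) (PiE UNIV (\<lambda>_ :: 'a. {0..1 :: real}))"
    unfolding compactin_PiE by simp
  then show ?thesis
    by (simp add: euclidean_product_topology PiE_def Pi_def)
qed

lemma lhs_subset:
  assumes "fds_over n F" "(LS, i) \<in> F"
  shows "LS \<subseteq> {1..n}"
  using assms by (auto simp: fds_over_def)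

lemma finite_lhs:
  assumes "fds_over n F"
  shows "finite {LS. (LS, i) \<in> F}"
proof (rule finite_subset)
  show "{LS. (LS, i) \<in> F} \<subseteq> fst ` F" by force
  show "finite (fst ` F)" using assms by (simp add: fds_over_def)
qed

lemma card_lhs_le_max_lhs_count:
  assumes "fds_over n F" "i \<in> {1..n}"
  shows "card {LS. (LS, i) \<in> F} \<le> max_lhs_count n F"
proof -
  have "{LS. (LS, i) \<in> F} = {LS. LS \<subseteq> {1..n} \<and> (LS, i) \<in> F}"
    using lhs_subset[OF assms(1)] by blast
  then show ?thesis
    unfolding max_lhs_count_def using assms(2) by (auto intro!: Max_ge)
qed

lemma lp_feasible_indicator:
  assumes "fds_over n F" "tcand1_feasible n F T X"
  shows "lp_feasible n F T (\<lambda>j. of_bool (j \<in> X)) (\<lambda>LS. of_bool (LS \<subseteq> X))"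
proof -
  have "1 \<le> of_bool (i \<in> X) + (\<Sum>LS \<in> {LS. (LS, i) \<in> F}. of_bool (LS \<subseteq> X) :: real)"
    if "i \<in> T" for i
  proof (cases "i \<in> X")
    case True
    then show ?thesis by (simp add: sum_nonneg)
  next
    case False
    with that assms(2) obtain LS where LS: "(LS, i) \<in> F" "LS \<subseteq> X"
      by (auto simp: tcand1_feasible_def one_step_closure_def)
    \<comment> \<open>One dependency that fires on \<open>X\<close> already contributes 1; the other
      summands are nonnegative.\<close>
    have "of_bool (LS \<subseteq> X) \<le> (\<Sum>LS \<in> {LS. (LS, i) \<in> F}. of_bool (LS \<subseteq> X) :: real)"
      by (rule member_le_sum) (use LS finite_lhs[OF assms(1)] in auto)
    with LS False show ?thesis by simp
  qed
  then show ?thesis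
    unfolding lp_feasible_def by auto
qed

text \<open>Used to move any solution into the compact cube. Coordinates bounded by the LP already
  lie in [0,1] and stay fixed, the others are unconstrained or occur only in
  \<open>z LS \<le> y j\<close>, which survives because clipping is monotone.\<close>

lemma lp_feasible_clip:
  assumes "T \<subseteq> {1..n}" "lp_feasible n F T y z"
  shows "lp_feasible n F T (\<lambda>j. max 0 (min 1 (y j))) (\<lambda>LS. max 0 (min 1 (z LS)))"
proof -
  have y: "max 0 (min 1 (y j)) = y j" if "j \<in> {1..n}" for j
    using assms(2) that by (auto simp: lp_feasible_def)
  have z: "max 0 (min 1 (z LS)) = z LS" if "(LS, i) \<in> F" "i \<in> T" for LS i
    using assms(2) that by (force simp: lp_feasible_def)
  have "(\<Sum>LS \<in> {LS. (LS, i) \<in> F}. max 0 (min 1 (z LS))) = (\<Sum>LS \<in> {LS. (LS, i) \<in> F}. z LS)"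
    if "i \<in> T" for i
    using that z by (intro sum.cong) auto
  moreover have "y i + (\<Sum>LS \<in> {LS. (LS, i) \<in> F}. z LS) \<ge> 1" "max 0 (min 1 (y i)) = y i"
    if "i \<in> T" for i
    using that assms y by (auto simp: lp_feasible_def)
  moreover have "max 0 (min 1 (z LS)) \<le> max 0 (min 1 (y j))"
    if "(LS, i) \<in> F" "i \<in> T" "j \<in> LS" for LS i j
  proof -
    have "z LS \<le> y j"
      using assms(2) that by (force simp: lp_feasible_def)
    then show ?thesis by linarith
  qed
  ultimately show ?thesis
    unfolding lp_feasible_def by auto
qed

lemma continuous_on_coordinate:
  "continuous_on S (\<lambda>p. fst p j)" "continuous_on S (\<lambda>p. snd p k)"
  for S :: "(('a \<Rightarrow> 'b :: topological_space) \<times> ('c \<Rightarrow> 'd :: topological_space)) set"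
  by (rule continuous_on_product_then_coordinatewise, rule continuous_on_fst continuous_on_snd,
      rule continuous_on_id)+

text \<open>Every constraint is a weak inequality between finite sums of coordinates (a sum over an
  infinite set is 0, still continuous). The premises of the implications do not depend on
  \<open>(y, z)\<close>, so they define open sets.\<close>

lemma closed_lp_feasible: "closed {(y, z). lp_feasible n F T y z}"
  unfolding lp_feasible_def case_prod_beta Ball_def
  by (intro closed_Collect_conj closed_Collect_all closed_Collect_imp closed_Collect_le
      continuous_on_add continuous_on_sum continuous_on_const continuous_on_coordinate
      open_Collect_const)

lemma lp_optimal_exists:
  assumes "fds_over n F" "T \<subseteq> {1..n}"
  shows "\<exists>y z. lp_optimal n F T y z"
proof -
  define B where "B = {y :: nat \<Rightarrow> real. \<forall>j. y j \<in> {0..1}} \<times> {z :: nat set \<Rightarrow> real. \<forall>LS. z LS \<in> {0..1}}"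
  \<comment> \<open>The feasible region itself need not be compact, as unconstrained coordinates are
    arbitrary; its part inside the cube is.\<close>
  define S where "S = B \<inter> {(y, z). lp_feasible n F T y z}"
  have clip: "(\<lambda>j. max 0 (min 1 (y j)), \<lambda>LS. max 0 (min 1 (z LS))) \<in> S"
    if "lp_feasible n F T y z" for y z
    using lp_feasible_clip[OF assms(2) that] by (simp add: S_def B_def)
  have "tcand1_feasible n F T {1..n}"
    using assms(2) by (auto simp: tcand1_feasible_def one_step_closure_def)
  with clip lp_feasible_indicator[OF assms(1)] have "S \<noteq> {}"
    by blast
  moreover have "compact S"
    unfolding S_def B_def
    by (intro compact_Int_closed compact_Times compact_unit_cube closed_lp_feasible)
  moreover have "continuous_on S (\<lambda>p. \<Sum>j = 1..n. fst p j)"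
    by (intro continuous_on_sum continuous_on_coordinate)
  ultimately obtain p where p: "p \<in> S" "\<And>q. q \<in> S \<Longrightarrow> (\<Sum>j = 1..n. fst p j) \<le> (\<Sum>j = 1..n. fst q j)"
    using continuous_attains_inf by meson
  \<comment> \<open>Minimality within \<open>S\<close> extends to all solutions: clipping lands in
    \<open>S\<close> and keeps the objective, which sees only \<open>y\<close> on
    \<open>{1..n}\<close>.\<close>
  have "(\<Sum>j = 1..n. fst p j) \<le> (\<Sum>j = 1..n. y j)" if f: "lp_feasible n F T y z" for y z
  proof -
    have "(\<Sum>j = 1..n. fst p j) \<le> (\<Sum>j = 1..n. max 0 (min 1 (y j)))"
      using p(2)[OF clip[OF f]] by simp
    also have "\<dots> = (\<Sum>j = 1..n. y j)"
      using f by (intro sum.cong) (auto simp: lp_feasible_def)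
    finally show ?thesis .
  qed
  with p(1) have "lp_optimal n F T (fst p) (snd p)"
    by (auto simp: lp_optimal_def S_def)
  then show ?thesis by blast
qed

lemma lp_optimal_le_opt:
  assumes "fds_over n F" "T \<subseteq> {1..n}" "lp_optimal n F T y z"
  shows "(\<Sum>j = 1..n. y j) \<le> real (tcand1_opt n F T)"
proof -
  have "{X. tcand1_feasible n F T X} \<subseteq> Pow {1..n}"
    by (auto simp: tcand1_feasible_def)
  then have "finite {X. tcand1_feasible n F T X}"
    by (rule finite_subset) simp
  moreover have "tcand1_feasible n F T {1..n}"
    using assms(2) by (auto simp: tcand1_feasible_def one_step_closure_def)
  \<comment> \<open>The minimum is attained, so some minimum feasible set can serve as an LP
    solution.\<close>
  ultimately have "tcand1_opt n F T \<in> card ` {X. tcand1_feasible n F T X}"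
    unfolding tcand1_opt_def by (intro Min_in) auto
  then obtain X where X: "tcand1_feasible n F T X" "tcand1_opt n F T = card X"
    by auto
  have "(\<Sum>j = 1..n. y j) \<le> (\<Sum>j = 1..n. of_bool (j \<in> X))"
    using assms(3) lp_feasible_indicator[OF assms(1) X(1)] by (auto simp: lp_optimal_def)
  also have "\<dots> = real (card X)"
    using X(1) by (simp add: tcand1_feasible_def of_bool_def sum.If_cases Int_absorb1)
  finally show ?thesis by (simp add: X(2))
qed

lemma rounding_feasible:
  assumes "fds_over n F" "T \<subseteq> {1..n}" "lp_feasible n F T y z"
  shows "tcand1_feasible n F T {i \<in> {1..n}. y i \<ge> 1 / (real (max_lhs_count n F) + 1)}"
proof -
  define \<theta> where "\<theta> = 1 / (real (max_lhs_count n F) + 1)"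
  \<comment> \<open>This holds for any natural number as \<open>max_lhs_count n F\<close>, including
    the unspecified value at \<open>n = 0\<close>.\<close>
  have \<theta>: "\<theta> > 0" "(real (max_lhs_count n F) + 1) * \<theta> = 1"
    by (auto simp: \<theta>_def)
  have "i \<in> one_step_closure n F {i \<in> {1..n}. y i \<ge> \<theta>}" if i: "i \<in> T" for i
  proof (cases "y i \<ge> \<theta>")
    case True
    then show ?thesis using i assms(2) by (auto simp: one_step_closure_def)
  next
    case False
    have "\<exists>LS. (LS, i) \<in> F \<and> z LS \<ge> \<theta>"
    proof (rule ccontr)
      assume "\<nexists>LS. (LS, i) \<in> F \<and> z LS \<ge> \<theta>"
      then have "(\<Sum>LS \<in> {LS. (LS, i) \<in> F}. z LS) \<le> real (card {LS. (LS, i) \<in> F}) * \<theta>"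
        by (intro sum_bounded_above) force
      also have "\<dots> \<le> real (max_lhs_count n F) * \<theta>"
        using card_lhs_le_max_lhs_count[OF assms(1)] i assms(2) \<theta>(1) by auto
      \<comment> \<open>With f the value of \<open>max_lhs_count n F\<close>, the total is below
        \<open>(f + 1) * \<theta> = 1\<close>. Strictness comes from \<open>y i < \<theta>\<close>,
        so it persists when no dependency has right-hand side \<open>i\<close>.\<close>
      finally have "y i + (\<Sum>LS \<in> {LS. (LS, i) \<in> F}. z LS) < 1"
        using False \<theta>(2) by (simp add: algebra_simps)
      with assms(3) i show False
        by (force simp: lp_feasible_def)
    qed
    then obtain LS where LS: "(LS, i) \<in> F" "z LS \<ge> \<theta>" by blast
    have "LS \<subseteq> {i \<in> {1..n}. y i \<ge> \<theta>}"
      using assms(3) i LS lhs_subset[OF assms(1) LS(1)] by (force simp: lp_feasible_def)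
    then show ?thesis
      using LS(1) i assms(2) by (auto simp: one_step_closure_def)
  qed
  then show ?thesis
    by (auto simp: tcand1_feasible_def \<theta>_def)
qed

text \<open>Markov's inequality for counting: each selected element contributes at least
  \<open>1 / c\<close> to the sum, and the rest contribute nonnegatively.\<close>

lemma card_threshold_le:
  assumes "finite A" "\<And>j. j \<in> A \<Longrightarrow> 0 \<le> y j" "c > 0"
  shows "real (card {j \<in> A. y j \<ge> 1 / c}) \<le> c * (\<Sum>j \<in> A. y j)"
proof -
  have "real (card {j \<in> A. y j \<ge> 1 / c}) * (1 / c) \<le> (\<Sum>j \<in> {j \<in> A. y j \<ge> 1 / c}. y j)"
    by (rule sum_bounded_below) simp
  also have "\<dots> \<le> (\<Sum>j \<in> A. y j)"
    by (rule sum_mono2) (use assms in auto)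
  finally show ?thesis
    using assms(3) by (simp add: field_simps)
qed

theorem theorem4:
  fixes n :: nat and F :: "fd set" and T :: "nat set"
  assumes "fds_over n F" and "T \<subseteq> {1..n}"
  shows "tcand1_approximation n F T (real (max_lhs_count n F) + 1) (lp_rounding_outputs n F T)"
proof -
  let ?c = "real (max_lhs_count n F) + 1"
  have "real (card {i \<in> {1..n}. y i \<ge> 1 / ?c}) \<le> ?c * real (tcand1_opt n F T)"
    if "lp_optimal n F T y z" for y z
  proof -
    have "real (card {i \<in> {1..n}. y i \<ge> 1 / ?c}) \<le> ?c * (\<Sum>j = 1..n. y j)"
      using that by (intro card_threshold_le) (auto simp: lp_optimal_def lp_feasible_def)
    also have "\<dots> \<le> ?c * real (tcand1_opt n F T)"
      by (intro mult_left_mono lp_optimal_le_opt[OF assms that]) simp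
    finally show ?thesis .
  qed
  moreover have "lp_rounding_outputs n F T \<noteq> {}"
    using lp_optimal_exists[OF assms] by (auto simp: lp_rounding_outputs_def)
  ultimately show ?thesis
    using rounding_feasible[OF assms]
    by (auto simp: tcand1_approximation_def lp_rounding_outputs_def lp_optimal_def)
qed

end
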